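(* Let $n\ge 1$ and let $K_n$ be the complete graph on $n$ vertices. For any linear ordering of the vertices of $K_n$, we have $\mathcal{D}(K_n)=\mathcal{D}_{V(K_n)}$, where $\mathcal{D}_{V(K_n)}$ is the set of all derangements of the vertex set $V(K_n)$.
   Context: A derangement of a finite set is a permutation of it with no fixed points. **Ordered graphs and edge operations.** An ordered graph is a finite simple graph $G$ together with a linear order on its vertex set $V(G)$; $|G|$ is the number of vertices. If the maximal vertex $t$ of $G$ is not isolated, the maximal edge of $G$ is $e=\{s,t\}$, where $s$ is the maximal vertex adjacent to $t$. For $e=\{s,t\}$ with $s<t$: - Deletion: $G-e$ is $G$ with the edge $e$ removed (same vertices, same order). A permutation of $V(G-e)$ is a permutation of $V(G)$. - Simple contraction: $G/e$ is obtained by contracting $e$ to a single vertex $x$ and removing loops and redundant (multiple) edges; $x$ takes the place of $s$ in the order. For a permutation $w$ of $V(G/e)$, $w_{st}$ denotes the permutation of $V(G)$ obtained by writing $w$ in cycle notation and replacing $x$ by the two consecutive letters $s\,t$ in its cycle. - Extraction: $G-[e]$ is obtained by removing $e$ and its two incident vertices $s,t$ (restricted order). For a permutation $w$ of $V(G-[e])$, $w\sqcup(st)$ is the permutation of $V(G)$ equal to $w$ on $V(G)\setminus\{s,t\}$ and exchanging $s$ and $t$. **The set $\mathcal{D}(G)$.** For a nonempty ordered graph $G$ with maximal vertex $t$, the set $\mathcal{D}(G)$ of permutations of $V(G)$ is defined recursively: - If $V(G)=\{s,t\}$ and $s,t$ are adjacent, then $\mathcal{D}(G)=\{(st)\}$.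 - If $t$ is isolated, then $\mathcal{D}(G)=\emptyset$. - If $t$ is not isolated, $|G|\ge 3$, and $e=\{s,t\}$ is the maximal edge, then $$\mathcal{D}(G)=\mathcal{D}(G-e)\cup\{w_{st}: w\in\mathcal{D}(G/e)\}\cup\{w\sqcup(st): w\in\mathcal{D}(G-[e])\}.$$ *)

theory Defs
  imports "HOL-Combinatorics.Permutations"
begin

text \<open>
  Ordered graphs: edges are two-element sets of vertices, and \<open>vorder\<close> is the reflexive
  linear order, with \<open>(u, v) \<in> vorder G\<close> meaning that \<open>u\<close> is below or equal to \<open>v\<close>.
\<close>

record 'a ograph =
  verts :: "'a set"
  edges :: "'a set set"
  vorder :: "'a rel"

definition ordered_graph :: "'a ograph \<Rightarrow> bool" where
  "ordered_graph G \<longleftrightarrow>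
     finite (verts G) \<and>
     edges G \<subseteq> {e. e \<subseteq> verts G \<and> card e = 2} \<and>
     linear_order_on (verts G) (vorder G)"

definition adjacent :: "'a ograph \<Rightarrow> 'a \<Rightarrow> 'a \<Rightarrow> bool" where
  "adjacent G u v \<longleftrightarrow> {u, v} \<in> edges G"

definition isolated :: "'a ograph \<Rightarrow> 'a \<Rightarrow> bool" where
  "isolated G v \<longleftrightarrow> (\<forall>u\<in>verts G. \<not> adjacent G u v)"

definition max_elem :: "'a rel \<Rightarrow> 'a set \<Rightarrow> 'a" where
  "max_elem r A = (THE m. m \<in> A \<and> (\<forall>a\<in>A. (a, m) \<in> r))"

definition max_vertex :: "'a ograph \<Rightarrow> 'a" where
  "max_vertex G = max_elem (vorder G) (verts G)"

text \<open>If \<open>t\<close> is the maximal vertex, the maximal edge is \<open>{max_neighbour G t, t}\<close>.\<close>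

definition max_neighbour :: "'a ograph \<Rightarrow> 'a \<Rightarrow> 'a" where
  "max_neighbour G t = max_elem (vorder G) {s \<in> verts G. adjacent G s t}"

definition del_edge :: "'a ograph \<Rightarrow> 'a \<Rightarrow> 'a \<Rightarrow> 'a ograph" where
  "del_edge G s t = G\<lparr>edges := edges G - {{s, t}}\<rparr>"

text \<open>
  The vertex obtained by contracting \<open>{s, t}\<close> takes the place of \<open>s\<close> in the order; it is
  represented by \<open>s\<close> itself. Images of edges of cardinality 1 are loops; multiple edges are
  identified because \<open>edges\<close> is a set.
\<close>

definition contract_edge :: "'a ograph \<Rightarrow> 'a \<Rightarrow> 'a \<Rightarrow> 'a ograph" where
  "contract_edge G s t =
     \<lparr>verts = verts G - {t},
      edges = {e \<in> (`) (id(t := s)) ` edges G. card e = 2},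
      vorder = Restr (vorder G) (verts G - {t})\<rparr>"

definition extract_edge :: "'a ograph \<Rightarrow> 'a \<Rightarrow> 'a \<Rightarrow> 'a ograph" where
  "extract_edge G s t =
     \<lparr>verts = verts G - {s, t},
      edges = {e \<in> edges G. s \<notin> e \<and> t \<notin> e},
      vorder = Restr (vorder G) (verts G - {s, t})\<rparr>"

text \<open>
  A permutation of \<open>A\<close> is a function \<open>w\<close> with \<open>w permutes A\<close>, so it is the identity outside \<open>A\<close>.

  Replacing the letter \<open>s\<close> (the contracted vertex) by \<open>s t\<close> in the cycle
  \<open>(\<dots> s w(s) \<dots>)\<close> yields \<open>(\<dots> s t w(s) \<dots>)\<close>.
\<close>

definition expand_perm :: "'a \<Rightarrow> 'a \<Rightarrow> ('a \<Rightarrow> 'a) \<Rightarrow> 'a \<Rightarrow> 'a" where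
  "expand_perm s t w = w(s := t, t := w s)"

definition adjoin_swap :: "'a \<Rightarrow> 'a \<Rightarrow> ('a \<Rightarrow> 'a) \<Rightarrow> 'a \<Rightarrow> 'a" where
  "adjoin_swap s t w = w(s := t, t := s)"

lemma max_elem_eqI:
  assumes "antisym r" "m \<in> A" "\<And>a. a \<in> A \<Longrightarrow> (a, m) \<in> r"
  shows "max_elem r A = m"
  unfolding max_elem_def using assms by (blast dest: antisymD)

lemma max_elem_props:
  assumes "linear_order_on V r" "finite A" "A \<subseteq> V" "A \<noteq> {}"
  shows max_elem_in: "max_elem r A \<in> A"
    and max_elem_ge: "\<And>a. a \<in> A \<Longrightarrow> (a, max_elem r A) \<in> r"
proof -
  have r: "antisym r" "trans r" "\<And>a. a \<in> V \<Longrightarrow> (a, a) \<in> r"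
    "\<And>a b. a \<in> V \<Longrightarrow> b \<in> V \<Longrightarrow> (a, b) \<in> r \<or> (b, a) \<in> r"
    using assms(1) by (simp_all add: order_on_defs total_on_def refl_on_def) metis
  have "\<exists>m\<in>A. \<forall>a\<in>A. (a, m) \<in> r"
    using assms(2,4,3)
  proof (induction A rule: finite_ne_induct)
    case (singleton x)
    then show ?case using r(3) by blast
  next
    case (insert x F)
    then obtain m where m: "m \<in> F" "\<forall>a\<in>F. (a, m) \<in> r" by blast
    consider "(x, m) \<in> r" | "(m, x) \<in> r" using r(4)[of x m] insert.prems m(1) by blast
    then show ?case
    proof cases
      case 1
      then show ?thesis using m by blast
    next
      case 2
      have "\<forall>a\<in>insert x F. (a, x) \<in> r"
        using 2 m r(3)[of x] insert.prems transD[OF r(2)] by blast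
      then show ?thesis by blast
    qed
  qed
  then obtain m where m: "m \<in> A" "\<And>a. a \<in> A \<Longrightarrow> (a, m) \<in> r" by blast
  have "max_elem r A = m" using max_elem_eqI r(1) m by metis
  then show "max_elem r A \<in> A" "\<And>a. a \<in> A \<Longrightarrow> (a, max_elem r A) \<in> r" using m by auto
qed

lemma max_vertex_in:
  "ordered_graph G \<Longrightarrow> verts G \<noteq> {} \<Longrightarrow> max_vertex G \<in> verts G"
  unfolding ordered_graph_def max_vertex_def by (blast intro: max_elem_in)

lemma max_neighbour_props:
  assumes "ordered_graph G" "\<not> isolated G t"
  shows "max_neighbour G t \<in> verts G" "{max_neighbour G t, t} \<in> edges G"
proof -
  have "max_neighbour G t \<in> {s \<in> verts G. adjacent G s t}"
    unfolding max_neighbour_def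
    by (rule max_elem_in[of "verts G"]) (use assms in \<open>auto simp: ordered_graph_def isolated_def\<close>)
  then show "max_neighbour G t \<in> verts G" "{max_neighbour G t, t} \<in> edges G"
    by (auto simp: adjacent_def)
qed

lemma finite_edges: "ordered_graph G \<Longrightarrow> finite (edges G)"
  unfolding ordered_graph_def by (rule finite_subset[of _ "Pow (verts G)"]) auto

lemma linear_order_on_Restr':
  assumes "linear_order_on V r" "A \<subseteq> V"
  shows "linear_order_on A (Restr r A)"
proof -
  have r: "antisym r" "trans r" "refl_on V r" "total_on V r"
    using assms(1) by (simp_all add: order_on_defs)
  have "refl_on A (Restr r A)" "total_on A (Restr r A)"
    using r(3,4) assms(2) by (auto simp: refl_on_def total_on_def)
  moreover have "antisym (Restr r A)" "trans (Restr r A)"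
    using r(1,2) by (blast intro: antisym_Restr trans_Restr)+
  ultimately show ?thesis by (simp add: order_on_defs)
qed

lemma ordered_graph_del_edge: "ordered_graph G \<Longrightarrow> ordered_graph (del_edge G s t)"
  unfolding ordered_graph_def del_edge_def by auto

lemma ordered_graph_contract_edge:
  assumes "ordered_graph G" "s \<in> verts G" "s \<noteq> t"
  shows "ordered_graph (contract_edge G s t)"
proof -
  have "id(t := s) ` e \<subseteq> verts G - {t}" if "e \<in> edges G" for e
    using that assms unfolding ordered_graph_def by (auto split: if_splits)
  then show ?thesis
    using assms unfolding ordered_graph_def contract_edge_def
    by (auto intro!: linear_order_on_Restr')
qed

lemma ordered_graph_extract_edge:
  "ordered_graph G \<Longrightarrow> ordered_graph (extract_edge G s t)"
  unfolding ordered_graph_def extract_edge_def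
  by (auto intro!: linear_order_on_Restr')

text \<open>
  The guard \<open>ordered_graph G \<and> verts G \<noteq> {}\<close> only makes the function total: by the lemmas above
  and because the extraction branch is reached only for at least three vertices, it holds for
  every recursive call made from a nonempty ordered graph. As \<open>s\<close> and \<open>t\<close> are distinct vertices,
  \<open>verts G = {s, t}\<close> fails exactly when there are at least three vertices.
\<close>

function D :: "'a ograph \<Rightarrow> ('a \<Rightarrow> 'a) set" where
  "D G =
    (if ordered_graph G \<and> verts G \<noteq> {} then
       let t = max_vertex G; s = max_neighbour G t in
       if isolated G t then {}
       else if verts G = {s, t} then {transpose s t}
       else D (del_edge G s t)
          \<union> expand_perm s t ` D (contract_edge G s t)
          \<union> adjoin_swap s t ` D (extract_edge G s t)
     else {})"
  by auto

termination
proof (relation "measure (\<lambda>G. card (verts G) + card (edges G))", goal_cases)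
  case 1
  show ?case by simp
next
  case (2 G t s)
  have "{s, t} \<in> edges G" using max_neighbour_props(2)[of G t] 2 by simp
  then have "card (edges G - {{s, t}}) < card (edges G)"
    using finite_edges[of G] 2 by (intro psubset_card_mono) auto
  then show ?case by (simp add: del_edge_def)
next
  case (3 G t s)
  have t: "t \<in> verts G" "finite (verts G)"
    using max_vertex_in[of G] 3 by (auto simp: ordered_graph_def)
  then have "card (verts G - {t}) < card (verts G)"
    by (intro psubset_card_mono) auto
  moreover have "card {e \<in> (`) (id(t := s)) ` edges G. card e = 2} \<le> card (edges G)"
    using finite_edges[of G] 3
    by (intro order_trans[OF card_mono card_image_le[of "edges G" "(`) (id(t := s))"]]) auto
  ultimately show ?case by (simp add: contract_edge_def)
next
  case (4 G t s)
  have t: "t \<in> verts G" "finite (verts G)"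
    using max_vertex_in[of G] 4 by (auto simp: ordered_graph_def)
  then have "card (verts G - {s, t}) < card (verts G)"
    by (intro psubset_card_mono) auto
  moreover have "card {e \<in> edges G. s \<notin> e \<and> t \<notin> e} \<le> card (edges G)"
    using finite_edges[of G] 4 by (intro card_mono) auto
  ultimately show ?case by (simp add: extract_edge_def)
qed

declare D.simps [simp del]

definition complete_ograph :: "'a set \<Rightarrow> 'a rel \<Rightarrow> 'a ograph" where
  "complete_ograph V r = \<lparr>verts = V, edges = {e. e \<subseteq> V \<and> card e = 2}, vorder = r\<rparr>"

definition derangements :: "'a set \<Rightarrow> ('a \<Rightarrow> 'a) set" where
  "derangements A = {w. w permutes A \<and> (\<forall>a\<in>A. w a \<noteq> a)}"

end

theory Submission imports Defs begin

text \<open>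
  Let \<open>t\<close> be the maximal vertex. Unrolling only the deletions in the recursion removes the edges at
  \<open>t\<close> one at a time; when the edge \<open>{s, t}\<close> is processed, contracting or extracting it leaves
  complete graphs on \<open>V - {t}\<close> and \<open>V - {s, t}\<close>. By induction these contribute exactly the
  derangements \<open>w\<close> with \<open>w s = t\<close>: those with \<open>w t \<noteq> s\<close> from the contraction, those with
  \<open>w t = s\<close> from the extraction. Every derangement sends some \<open>s \<noteq> t\<close> to \<open>t\<close>.
\<close>

text \<open>In this form the operation visibly preserves permutations, and a second composition with
  \<open>transpose s t\<close> undoes it. The hypothesis enters at \<open>s\<close>, where the
  composite takes the value \<open>w t\<close>.\<close>

lemma expand_perm_eq_comp_transpose:
  "w t = t \<Longrightarrow> expand_perm s t w = w \<circ> transpose s t"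
  by (auto simp: expand_perm_def transpose_def)

lemma adjoin_swap_eq_comp_transpose:
  "w s = s \<Longrightarrow> w t = t \<Longrightarrow> adjoin_swap s t w = w \<circ> transpose s t"
  by (auto simp: adjoin_swap_def transpose_def)

lemma permutes_Diff_fixed:
  assumes "w permutes V" "\<And>x. x \<in> A \<Longrightarrow> w x = x"
  shows "w permutes (V - A)"
  using assms by (intro permutes_superset[OF assms(1)]) auto

lemma expand_perm_derangements:
  assumes "s \<in> V" "t \<in> V" "s \<noteq> t" "w \<in> derangements (V - {t})"
  shows "expand_perm s t w \<in> derangements V" "expand_perm s t w s = t"
proof -
  have w: "w permutes (V - {t})" "\<And>a. a \<in> V \<Longrightarrow> a \<noteq> t \<Longrightarrow> w a \<noteq> a"
    using assms(4) by (auto simp: derangements_def)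
  then have "w t = t" by (simp add: permutes_not_in)
  moreover have "w permutes V" using w(1) by (rule permutes_subset) blast
  ultimately have "expand_perm s t w permutes V"
    using assms by (simp add: expand_perm_eq_comp_transpose permutes_compose permutes_swap_id)
  \<comment> \<open>The expanded permutation sends \<open>t\<close> to \<open>w s\<close>, so
    \<open>t\<close> is moved because \<open>w\<close> maps \<open>V - {t}\<close> into
    itself.\<close>
  moreover have "w s \<noteq> t"
    using w(1) assms(1,3) by (metis DiffD2 DiffI permutes_in_image singletonD singletonI)
  ultimately show "expand_perm s t w \<in> derangements V"
    using w(2) assms(3) by (auto simp: derangements_def expand_perm_def)
  show "expand_perm s t w s = t"
    using assms(3) by (simp add: expand_perm_def)
qed

lemma adjoin_swap_derangements:
  assumes "s \<in> V" "t \<in> V" "s \<noteq> t" "w \<in> derangements (V - {s, t})"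
  shows "adjoin_swap s t w \<in> derangements V" "adjoin_swap s t w s = t"
proof -
  have w: "w permutes (V - {s, t})" "\<And>a. a \<in> V \<Longrightarrow> a \<noteq> s \<Longrightarrow> a \<noteq> t \<Longrightarrow> w a \<noteq> a"
    using assms(4) by (auto simp: derangements_def)
  then have "w s = s" "w t = t" by (simp_all add: permutes_not_in)
  moreover have "w permutes V" using w(1) by (rule permutes_subset) blast
  ultimately have "adjoin_swap s t w permutes V"
    using assms by (simp add: adjoin_swap_eq_comp_transpose permutes_compose permutes_swap_id)
  then show "adjoin_swap s t w \<in> derangements V"
    using w(2) assms(3) by (auto simp: derangements_def adjoin_swap_def)
  show "adjoin_swap s t w s = t"
    using assms(3) by (simp add: adjoin_swap_def)
qed

text \<open>Right composition with \<open>transpose s t\<close> is an involution, so it inverts both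
  operations at once. It turns \<open>w\<close> with \<open>w s = t\<close> into a permutation that
  fixes \<open>t\<close> and sends \<open>s\<close> to \<open>w t\<close>; whether \<open>s\<close>
  is fixed as well decides which of the two images contains \<open>w\<close>.\<close>

lemma derangements_mapping_to:
  assumes "s \<in> V" "t \<in> V" "s \<noteq> t"
  shows "{w \<in> derangements V. w s = t} =
    expand_perm s t ` derangements (V - {t}) \<union> adjoin_swap s t ` derangements (V - {s, t})"
    (is "?L = ?R")
proof (intro equalityI subsetI)
  fix w assume "w \<in> ?L"
  then have w: "w permutes V" "\<And>a. a \<in> V \<Longrightarrow> w a \<noteq> a" "w s = t"
    by (auto simp: derangements_def)
  define v where "v = w \<circ> transpose s t"
  have wv: "w = v \<circ> transpose s t"
    by (simp add: v_def comp_assoc)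
  have v: "v permutes V"
    using w(1) assms unfolding v_def by (simp add: permutes_compose permutes_swap_id)
  have vt: "v t = t" and vs: "v s = w t"
    using w(3) by (simp_all add: v_def)
  have v_moves: "v a \<noteq> a" if "a \<in> V" "a \<noteq> s" "a \<noteq> t" for a
    using w(2) that by (simp add: v_def)
  show "w \<in> ?R"
  proof (cases "w t = s")
    case True
    have "v permutes (V - {s, t})"
      using v vt vs True by (intro permutes_Diff_fixed) auto
    then have "v \<in> derangements (V - {s, t})"
      using v_moves by (auto simp: derangements_def)
    moreover have "w = adjoin_swap s t v"
      using vt vs True wv by (simp add: adjoin_swap_eq_comp_transpose)
    ultimately show ?thesis by blast
  next
    case False
    have "v permutes (V - {t})"
      using v vt by (intro permutes_Diff_fixed) auto
    moreover have "v a \<noteq> a" if "a \<in> V" "a \<noteq> t" for a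
      using that v_moves vs False by (cases "a = s") auto
    ultimately have "v \<in> derangements (V - {t})"
      by (auto simp: derangements_def)
    moreover have "w = expand_perm s t v"
      using vt wv by (simp add: expand_perm_eq_comp_transpose)
    ultimately show ?thesis by blast
  qed
next
  fix w assume "w \<in> ?R"
  then show "w \<in> ?L"
    using expand_perm_derangements[OF assms] adjoin_swap_derangements[OF assms] by blast
qed

text \<open>This matches the terminal clause of the recursion: a one-element set has no derangement,
  so the contraction term vanishes, while \<open>id\<close> is the only derangement of the empty set
  and becomes the transposition.\<close>

lemma derangements_pair:
  assumes "s \<noteq> t"
  shows "{w \<in> derangements {s, t}. w s = t} = {transpose s t}"
proof -
  have "derangements ({s, t} - {t}) = {}" "derangements ({s, t} - {s, t}) = {id}"
    using assms by (auto simp: derangements_def insert_Diff_if)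
  then show ?thesis
    using derangements_mapping_to[of s "{s, t}" t] assms
    by (simp add: adjoin_swap_eq_comp_transpose)
qed

text \<open>These are the graphs met while edges at \<open>t\<close> are deleted one by one, from
  the complete graph (\<open>S = V - {t}\<close>) down to isolated \<open>t\<close>
  (\<open>S = {}\<close>).\<close>

definition cone_ograph :: "'a set \<Rightarrow> 'a rel \<Rightarrow> 'a \<Rightarrow> 'a set \<Rightarrow> 'a ograph" where
  "cone_ograph V r t S =
     \<lparr>verts = V, edges = {e. e \<subseteq> V - {t} \<and> card e = 2} \<union> (\<lambda>u. {u, t}) ` S, vorder = r\<rparr>"

lemma complete_ograph_eq_cone:
  assumes "t \<in> V"
  shows "complete_ograph V r = cone_ograph V r t (V - {t})"
proof -
  have "e \<in> (\<lambda>u. {u, t}) ` (V - {t})" if "e \<subseteq> V" "card e = 2" "t \<in> e" for e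
    using that by (fastforce simp: card_2_iff)
  then show ?thesis
    using assms unfolding complete_ograph_def cone_ograph_def by (auto simp: card_2_iff)
qed

lemma ordered_graph_cone:
  assumes "finite V" "linear_order_on V r" "t \<in> V" "S \<subseteq> V - {t}"
  shows "ordered_graph (cone_ograph V r t S)"
  using assms by (auto simp: ordered_graph_def cone_ograph_def card_2_iff)

lemma adjacent_cone_apex:
  "u \<in> V \<Longrightarrow> S \<subseteq> V - {t} \<Longrightarrow> adjacent (cone_ograph V r t S) u t \<longleftrightarrow> u \<in> S"
  by (auto simp: adjacent_def cone_ograph_def doubleton_eq_iff)

lemma isolated_cone_apex:
  "S \<subseteq> V - {t} \<Longrightarrow> isolated (cone_ograph V r t S) t \<longleftrightarrow> S = {}"
  using adjacent_cone_apex[of _ V S t r] by (auto simp: isolated_def cone_ograph_def)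

lemma del_edge_cone:
  assumes "S \<subseteq> V - {t}"
  shows "del_edge (cone_ograph V r t S) s t = cone_ograph V r t (S - {s})"
  using assms by (auto simp: del_edge_def cone_ograph_def doubleton_eq_iff)

text \<open>The edge \<open>{s, t}\<close> becomes a loop and any other \<open>{u, t}\<close>
  becomes \<open>{u, s}\<close>, which the complete graph on \<open>V - {t}\<close> already
  contains. Hence the result does not depend on \<open>S\<close>.\<close>

lemma contract_edge_cone:
  assumes "S \<subseteq> V - {t}" "s \<in> S"
  shows "contract_edge (cone_ograph V r t S) s t =
    complete_ograph (V - {t}) (Restr r (V - {t}))"
proof -
  let ?E = "edges (cone_ograph V r t S)"
  have "e \<in> (`) (id(t := s)) ` ?E" if "e \<subseteq> V - {t}" "card e = 2" for e
  proof -
    \<comment> \<open>The contraction map moves only \<open>t\<close>, so an edge avoiding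
      \<open>t\<close> is its own image.\<close>
    have "id(t := s) ` e = e" using that by (force simp: fun_upd_def)
    moreover have "e \<in> ?E" using that by (simp add: cone_ograph_def)
    ultimately show ?thesis by (metis imageI)
  qed
  moreover have "id(t := s) ` e \<subseteq> V - {t}" if "e \<in> ?E" for e
    using that assms by (auto simp: cone_ograph_def split: if_splits)
  ultimately have "{e \<in> (`) (id(t := s)) ` ?E. card e = 2} = {e. e \<subseteq> V - {t} \<and> card e = 2}"
    by blast
  then show ?thesis
    by (simp add: contract_edge_def complete_ograph_def cone_ograph_def)
qed

lemma extract_edge_cone:
  "extract_edge (cone_ograph V r t S) s t =
    complete_ograph (V - {s, t}) (Restr r (V - {s, t}))"
  by (auto simp: extract_edge_def complete_ograph_def cone_ograph_def)

text \<open>Allowing every \<open>S\<close> makes the deletion term an instance of the same claim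
  with \<open>S - {s}\<close>, so induction on \<open>S\<close> applies. Contraction and extraction
  give complete graphs on fewer vertices, which \<open>IH\<close> covers; it is supplied by the
  later induction on \<open>V\<close>.\<close>

lemma D_cone:
  assumes V: "finite V" "linear_order_on V r" "V \<noteq> {}"
    and t: "t = max_elem r V"
    and S: "S \<subseteq> V - {t}"
    and IH: "\<And>U q. U \<subset> V \<Longrightarrow> U \<noteq> {} \<Longrightarrow> linear_order_on U q \<Longrightarrow>
      D (complete_ograph U q) = derangements U"
  shows "D (cone_ograph V r t S) = {w \<in> derangements V. \<exists>s\<in>S. w s = t}"
proof -
  have tV: "t \<in> V" unfolding t by (rule max_elem_in[OF V(2,1) subset_refl V(3)])
  have "finite S" using S V(1) by (meson finite_Diff finite_subset)
  then show ?thesis using S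
  proof (induction S rule: finite_psubset_induct)
    case (psubset S)
    let ?G = "cone_ograph V r t S"
    define s where "s = max_neighbour ?G t"
    have G: "ordered_graph ?G" "verts ?G = V" "max_vertex ?G = t"
      using ordered_graph_cone[OF V(1,2) tV psubset.prems]
      by (simp_all add: max_vertex_def cone_ograph_def t)
    have D_G: "D ?G =
      (if S = {} then {}
       else if V = {s, t} then {transpose s t}
       else D (del_edge ?G s t)
          \<union> expand_perm s t ` D (contract_edge ?G s t)
          \<union> adjoin_swap s t ` D (extract_edge ?G s t))"
      by (subst D.simps) (simp add: G V(3) s_def Let_def isolated_cone_apex[OF psubset.prems])
    show ?case
    proof (cases "S = {}")
      case True
      then show ?thesis unfolding D_G by simp
    next
      case False
      have "s \<in> V" "adjacent ?G s t"
        using max_neighbour_props[OF G(1), of t] False G(2)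
        by (simp_all add: isolated_cone_apex[OF psubset.prems] s_def adjacent_def)
      then have s: "s \<in> S" "s \<in> V" "s \<noteq> t"
        using adjacent_cone_apex psubset.prems by fastforce+
      show ?thesis
      \<comment> \<open>Two vertices are treated apart: extraction would leave the empty graph, on
        which \<open>D\<close> is empty although \<open>id\<close> is a derangement of the empty
        set.\<close>
      proof (cases "V = {s, t}")
        case True
        then have "S = {s}" using s psubset.prems by blast
        then show ?thesis
          unfolding D_G using True derangements_pair[OF s(3)] by simp
      next
        case False
        have "D (contract_edge ?G s t) = derangements (V - {t})"
          unfolding contract_edge_cone[OF psubset.prems s(1)]
          using tV s V(2) by (intro IH linear_order_on_Restr') auto
        \<comment> \<open>Since \<open>V \<noteq> {s, t}\<close>, the remaining vertex set is
          nonempty, as \<open>IH\<close> requires.\<close>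
        moreover have "D (extract_edge ?G s t) = derangements (V - {s, t})"
          unfolding extract_edge_cone
          using tV s V(2) False by (intro IH linear_order_on_Restr') auto
        moreover have "D (del_edge ?G s t) = {w \<in> derangements V. \<exists>u\<in>S - {s}. w u = t}"
          unfolding del_edge_cone[OF psubset.prems]
          using s psubset.prems by (intro psubset.IH) auto
        ultimately have "D ?G = {w \<in> derangements V. \<exists>u\<in>S - {s}. w u = t}
            \<union> {w \<in> derangements V. w s = t}"
          unfolding D_G using \<open>S \<noteq> {}\<close> False derangements_mapping_to[OF s(2) tV s(3)]
          by (simp add: Un_assoc)
        then show ?thesis using s(1) by blast
      qed
    qed
  qed
qed

text \<open>The induction on \<open>V\<close> keeps \<open>r\<close> arbitrary, because the smaller
  complete graphs carry restrictions of the order.\<close>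

lemma D_complete_ograph:
  assumes "finite V" "V \<noteq> {}" "linear_order_on V r"
  shows "D (complete_ograph V r) = derangements V"
  using assms
proof (induction V arbitrary: r rule: finite_psubset_induct)
  case (psubset V)
  define t where "t = max_elem r V"
  have t: "t \<in> V"
    unfolding t_def using max_elem_in[OF psubset.prems(2) psubset.hyps subset_refl] psubset.prems by blast
  \<comment> \<open>The preimage of \<open>t\<close> differs from \<open>t\<close> because
    \<open>w\<close> moves \<open>t\<close>; so for \<open>S = V - {t}\<close> the condition in
    \<open>D_cone\<close> holds for every derangement.\<close>
  have "\<exists>s\<in>V - {t}. w s = t" if "w \<in> derangements V" for w
  proof -
    have w: "w permutes V" "w t \<noteq> t" using that t by (auto simp: derangements_def)
    obtain s where "s \<in> V" "w s = t" using permutes_image[OF w(1)] t by (metis imageE)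
    moreover have "s \<noteq> t" using calculation w(2) by metis
    ultimately show ?thesis by blast
  qed
  moreover have "D (cone_ograph V r t (V - {t})) = {w \<in> derangements V. \<exists>s\<in>V - {t}. w s = t}"
    using psubset by (intro D_cone) (auto simp: t_def)
  ultimately show ?case
    unfolding complete_ograph_eq_cone[OF t] by blast
qed

theorem corollary6p1:
  fixes V :: "'a set" and r :: "'a rel" and n :: nat
  assumes "n \<ge> 1"
    and "finite V"
    and "card V = n"
    and "linear_order_on V r"
  shows "D (complete_ograph V r) = derangements V"
  using assms by (intro D_complete_ograph) auto

end
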